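(* Let $\nu\ge1$, $\mathtt m\ge0$, $0<\gamma_0<1$, $\tau_0>\nu-1$, and fix $0\le\alpha\le1$. Assume $\mathtt M>1$ and $\mathtt M\ge\mathtt M_0$, where $\mathtt M_0:=\min\{\mathtt m^2,\langle\mathtt m\rangle^{1/\alpha}\}$ (with $\mathtt M_0:=\mathtt m^2$ if $\alpha=0$). Then, for $0<\widetilde\gamma\le\min\{\gamma_0^{3/2},1/8\}$ and $\widetilde\tau\ge2\nu+3$, the set $$\mathcal U_\alpha:=\Big\{\omega\in\Omega_0\ \Big|\ |\omega\cdot k+\lambda_j\pm\lambda_l|\ge\frac{\widetilde\gamma}{\langle k\rangle^{\widetilde\tau}}\frac{\langle j\pm l\rangle^\alpha}{\mathtt M^\alpha}\quad\forall(k,j,l)\in\mathcal I^\pm\Big\}$$ is of large relative measure, that is, $$\mathrm m_r(\Omega_0\setminus\mathcal U_\alpha)\le C\,\widetilde\gamma^{1/3},$$ where $C>0$ is independent of $\mathtt M$ and $\widetilde\gamma$.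
   Context: $\mathbb N=\{1,2,\dots\}$, $\langle\cdot\rangle=(1+|\cdot|^2)^{1/2}$, $|\cdot|$ is the Euclidean norm, $\lambda_j=\sqrt{j^2+\mathtt m^2}$ for $j\in\mathbb N$. $R_{\mathtt M}=\overline{B_{2\mathtt M}(0)}\setminus B_{\mathtt M}(0)\subset\mathbb R^\nu$ (Euclidean balls), and $\mathrm m_r(\Omega)=|\Omega|/|R_{\mathtt M}|$ where $|\cdot|$ of a set denotes Lebesgue measure. Moreover $$\Omega_0=\Big\{\omega\in R_{\mathtt M}\ \Big|\ |\omega\cdot k|\ge\frac{\gamma_0}{\langle k\rangle^{\tau_0}}\mathtt M\quad\forall k\in\mathbb Z^\nu\setminus\{0\}\Big\},$$ $$\mathcal I^+=\mathbb Z^\nu\times\mathbb N\times\mathbb N,\qquad \mathcal I^-=\{(k,j,l)\in\mathcal I^+\mid(k,j,l)\ne(0,a,a)\ \text{for all } a\in\mathbb N\}.$$ The condition defining $\mathcal U_\alpha$ is required for both choices of sign, the upper sign with $\mathcal I^+$ and the lower sign with $\mathcal I^-$. *)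

theory Defs
  imports "HOL-Analysis.Analysis"
begin

definition jap :: "'a::real_normed_vector \<Rightarrow> real" where
  "jap x = sqrt (1 + (norm x)\<^sup>2)"

definition real_vec :: "int ^ 'n \<Rightarrow> real ^ 'n" where
  "real_vec k = (\<chi> i. real_of_int (k $ i))"

definition freq :: "real \<Rightarrow> nat \<Rightarrow> real" where
  "freq m j = sqrt ((real j)\<^sup>2 + m\<^sup>2)"

definition annulus :: "real \<Rightarrow> (real ^ 'n) set" where
  "annulus M = closure (ball 0 (2 * M)) - ball 0 M"

definition rel_measure :: "real \<Rightarrow> (real ^ 'n) set \<Rightarrow> real" where
  "rel_measure M S = measure lebesgue S / measure lebesgue (annulus M :: (real ^ 'n) set)"

definition Omega0 :: "real \<Rightarrow> real \<Rightarrow> real \<Rightarrow> (real ^ 'n) set" where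
  "Omega0 \<gamma>0 \<tau>0 M =
    {\<omega> \<in> annulus M. \<forall>k :: int ^ 'n. k \<noteq> 0 \<longrightarrow>
       \<bar>\<omega> \<bullet> real_vec k\<bar> \<ge> \<gamma>0 / jap (real_vec k) powr \<tau>0 * M}"

text \<open>The mode indices \<open>j, l\<close> range over the positive integers.\<close>

definition index_plus :: "((int ^ 'n) \<times> nat \<times> nat) set" where
  "index_plus = UNIV \<times> {1..} \<times> {1..}"

definition index_minus :: "((int ^ 'n) \<times> nat \<times> nat) set" where
  "index_minus = {x \<in> index_plus. \<forall>a \<in> {1..}. x \<noteq> (0, a, a)}"

definition U_set ::
  "real \<Rightarrow> real \<Rightarrow> real \<Rightarrow> real \<Rightarrow> real \<Rightarrow> real \<Rightarrow> real \<Rightarrow> (real ^ 'n) set" where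
  "U_set m \<gamma>0 \<tau>0 \<alpha> \<gamma> \<tau> M =
    {\<omega> \<in> Omega0 \<gamma>0 \<tau>0 M.
       (\<forall>(k, j, l) \<in> index_plus.
          \<bar>\<omega> \<bullet> real_vec k + freq m j + freq m l\<bar>
            \<ge> \<gamma> / jap (real_vec k) powr \<tau> * (jap (real j + real l) powr \<alpha> / M powr \<alpha>)) \<and>
       (\<forall>(k, j, l) \<in> index_minus.
          \<bar>\<omega> \<bullet> real_vec k + freq m j - freq m l\<bar>
            \<ge> \<gamma> / jap (real_vec k) powr \<tau> * (jap (real j - real l) powr \<alpha> / M powr \<alpha>))}"

definition M_threshold :: "real \<Rightarrow> real \<Rightarrow> real" where
  "M_threshold m \<alpha> = (if \<alpha> = 0 then m\<^sup>2 else min (m\<^sup>2) (jap m powr (1 / \<alpha>)))"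

end

theory Submission
  imports Defs
begin

text \<open>
  Write \<open>n\<close> for the dimension and \<open>\<langle>k\<rangle>\<close> for \<open>jap (real_vec k)\<close>. A frequency is lost when for some
  \<open>(k, j, l)\<close> and some sign \<open>\<sigma>\<close> it lies in the slab of points \<open>\<omega>\<close> at which \<open>\<omega> \<bullet> k\<close> is close to
  \<open>- (freq m j + \<sigma> freq m l)\<close>. A slab of half-width \<open>d\<close> has relative measure at most a constant
  times \<open>d / (M |k|)\<close> (\<open>measure_slab_le_annulus\<close>), so the task is to cover the lost frequencies by
  few slabs, although for the difference of two frequencies infinitely many pairs \<open>(j, l)\<close>
  compete for a given \<open>k\<close>.

  Since \<open>freq m j\<close> differs from \<open>j\<close> by at most \<open>m\<close>, a resonance with \<open>k\<close> forces \<open>p = j + \<sigma> l\<close>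
  into a range of \<open>O(M |k|)\<close> integers (\<open>resonance_index_bound\<close>). The weight \<open>\<langle>p\<rangle>\<^sup>\<alpha> / M\<^sup>\<alpha>\<close> is then
  \<open>O(\<langle>k\<rangle>)\<close>, and all slabs belonging to \<open>k\<close> have half-width at most \<open>\<delta> = O(\<gamma> \<langle>k\<rangle>\<^sup>1\<^sup>-\<^sup>\<tau>)\<close>. Fix a
  threshold \<open>J\<close>. If \<open>j\<close> and \<open>l\<close> both exceed \<open>J\<close>, then \<open>freq m j = j + O(1 / j)\<close> puts
  \<open>freq m j + \<sigma> freq m l\<close> within \<open>O(1 / J)\<close> of the integer \<open>p\<close>
  (\<open>resonance_near_integer\<close>), and one slab of half-width \<open>\<delta> + O(1 / J)\<close> for each \<open>p\<close> is enough. The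
  other pairs are determined by \<open>p\<close>, \<open>\<sigma>\<close> and an index not exceeding \<open>J\<close>, so they give
  \<open>O(J M |k|)\<close> slabs of half-width \<open>\<delta>\<close> (\<open>card_low_mode_centres\<close>). The factors \<open>M |k|\<close> cancel, and the
  frequencies lost to \<open>k\<close> have relative measure \<open>O(1 / J + J \<delta>)\<close>. With
  \<open>1 / J = \<gamma> powr (1 / 2) * \<langle>k\<rangle> powr - (n + 1)\<close> and \<open>\<tau> \<ge> 2 n + 3\<close> both terms are of the order of
  \<open>1 / J\<close> (\<open>resonant_set_cover\<close>), which is summable over the lattice (\<open>lattice_sum_bounded\<close>).

  The vector \<open>k = 0\<close> loses nothing once \<open>\<gamma>\<close> is small in terms of \<open>m\<close>
  (\<open>Omega0_diff_U_set_subset\<close>); for all larger \<open>\<gamma>\<close> the assertion is trivial because a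
  relative measure is at most \<open>1\<close>. Altogether the loss is \<open>O(\<gamma> powr (1 / 2))\<close>, and
  \<open>\<gamma> powr (1 / 2) \<le> \<gamma> powr (1 / 3)\<close>.
\<close>

section \<open>Elementary bounds\<close>

lemma jap_ge_1: "1 \<le> jap x"
  by (simp add: jap_def)

lemma norm_le_jap: "norm x \<le> jap x"
  by (simp add: jap_def real_le_rsqrt)

lemma jap_le_1_plus_norm: "jap x \<le> 1 + norm x"
  unfolding jap_def by (rule real_le_lsqrt) (auto simp: power2_sum)

lemma freq_ge: "real j \<le> freq m j"
  by (simp add: freq_def real_le_rsqrt)

lemma freq_le_add:
  assumes "0 \<le> m"
  shows "freq m j \<le> real j + m"
  unfolding freq_def using assms by (intro real_le_lsqrt) (auto simp: power2_sum)

lemma freq_le_add_inverse: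
  assumes "0 < j"
  shows "freq m j \<le> real j + m\<^sup>2 / real j"
proof -
  have "(real j)\<^sup>2 + m\<^sup>2 \<le> (real j + m\<^sup>2 / real j)\<^sup>2"
    using assms by (simp add: power2_sum)
  then show ?thesis
    unfolding freq_def by (intro real_le_lsqrt) auto
qed

lemma norm_real_vec_ge_1:
  fixes k :: "int ^ 'n"
  assumes "k \<noteq> 0"
  shows "1 \<le> norm (real_vec k)"
proof -
  obtain i where "k $ i \<noteq> 0"
    using assms by (auto simp: vec_eq_iff)
  then have "1 \<le> \<bar>real_vec k $ i\<bar>"
    by (simp add: real_vec_def)
  also have "\<dots> \<le> norm (real_vec k)"
    by (rule component_le_norm_cart)
  finally show ?thesis .
qed

section \<open>Summing over the integer lattice\<close>

text \<open>The value at \<open>0\<close> is set to \<open>1\<close> so that the summand dominates the powers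
  \<open>jap z powr - a\<close> on all integers.\<close>

lemma int_powr_sum_bounded:
  fixes a :: real
  assumes "1 < a"
  defines "h \<equiv> \<lambda>z :: int. if z = 0 then 1 else \<bar>real_of_int z\<bar> powr - a"
  obtains Z where "0 < Z" "\<And>B. (\<Sum>z = - B..B. h z) \<le> Z"
proof -
  have h0: "0 \<le> h z" for z
    by (simp add: h_def)
  have "summable (\<lambda>n. h (int n))"
  proof (subst summable_cong)
    show "\<forall>\<^sub>F n in sequentially. h (int n) = of_nat n powr - a"
      using eventually_gt_at_top[of 0] by eventually_elim (simp add: h_def)
    show "summable (\<lambda>n. of_nat n powr - a :: real)"
      using assms(1) by (simp add: summable_real_powr_iff)
  qed
  then have half: "(\<Sum>n\<le>N. h (int n)) \<le> (\<Sum>n. h (int n))" for N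
    using h0 by (intro sum_le_suminf) auto
  show thesis
  proof
    show "0 < 2 * (\<Sum>n. h (int n))"
      using half[of 0] by (simp add: h_def)
    fix B :: int
    have "z \<in> int ` {..nat B} \<union> (\<lambda>n. - int n) ` {..nat B}" if "z \<in> {- B..B}" for z
    proof (cases "0 \<le> z")
      case True
      then show ?thesis using that by (intro UnI1 image_eqI[of _ _ "nat z"]) auto
    next
      case False
      then show ?thesis using that by (intro UnI2 image_eqI[of _ _ "nat (- z)"]) auto
    qed
    then have "{- B..B} \<subseteq> int ` {..nat B} \<union> (\<lambda>n. - int n) ` {..nat B}"
      by blast
    then have "(\<Sum>z = - B..B. h z) \<le> sum h (int ` {..nat B} \<union> (\<lambda>n. - int n) ` {..nat B})"
      using h0 by (intro sum_mono2) auto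
    also have "\<dots> \<le> sum h (int ` {..nat B}) + sum h ((\<lambda>n. - int n) ` {..nat B})"
      using h0 by (simp add: sum_Un sum_nonneg)
    also have "\<dots> = (\<Sum>n\<le>nat B. h (int n)) + (\<Sum>n\<le>nat B. h (int n))"
      by (subst (1 2) sum.reindex) (auto simp: inj_on_def h_def intro!: sum.cong)
    also have "\<dots> \<le> 2 * (\<Sum>n. h (int n))"
      using half[of "nat B"] by simp
    finally show "(\<Sum>z = - B..B. h z) \<le> 2 * (\<Sum>n. h (int n))" .
  qed
qed

text \<open>Spreading the exponent evenly over the coordinates bounds the summand by a product of
  one-dimensional factors with exponent \<open>s / n > 1\<close>, and the sum over a cube factorises.\<close>

lemma lattice_sum_bounded:
  assumes "real CARD('n::finite) < s"
  obtains S where "0 < S"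
    "\<And>F :: (int ^ 'n) set. finite F \<Longrightarrow> (\<Sum>k\<in>F. jap (real_vec k) powr - s) \<le> S"
proof -
  define a where "a = s / real CARD('n)"
  have a: "1 < a" "a * real CARD('n) = s"
    using assms by (auto simp: a_def field_simps)
  define h where "h = (\<lambda>z :: int. if z = 0 then 1 else \<bar>real_of_int z\<bar> powr - a)"
  have h0: "0 \<le> h z" for z
    by (simp add: h_def)
  obtain Z where Z: "0 < Z" "\<And>B. (\<Sum>z = - B..B. h z) \<le> Z"
    using int_powr_sum_bounded[OF a(1)] unfolding h_def by blast
  have summand: "jap (real_vec k) powr - s \<le> (\<Prod>i\<in>UNIV. h (k $ i))" for k :: "int ^ 'n"
  proof -
    have "jap (real_vec k) powr - s = (jap (real_vec k) powr - a) ^ CARD('n)"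
      using jap_ge_1[of "real_vec k"] a(2) by (simp add: powr_powr flip: powr_realpow)
    also have "\<dots> = (\<Prod>i\<in>(UNIV :: 'n set). jap (real_vec k) powr - a)"
      by simp
    also have "\<dots> \<le> (\<Prod>i\<in>UNIV. h (k $ i))"
    proof (rule prod_mono, intro conjI)
      fix i :: 'n
      show "jap (real_vec k) powr - a \<le> h (k $ i)"
      proof (cases "k $ i = 0")
        case True
        then show ?thesis
          using jap_ge_1[of "real_vec k"] a(1) by (simp add: h_def powr_minus ge_one_powr_ge_zero field_simps)
      next
        case False
        have "\<bar>real_of_int (k $ i)\<bar> \<le> norm (real_vec k)"
          using component_le_norm_cart[of "real_vec k" i] by (simp add: real_vec_def)
        also have "\<dots> \<le> jap (real_vec k)"
          by (rule norm_le_jap)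
        finally show ?thesis
          using False a(1) by (simp add: h_def powr_mono2')
      qed
    qed simp
    finally show ?thesis .
  qed
  show thesis
  proof
    show "0 < Z ^ CARD('n)"
      using Z by simp
    fix F :: "(int ^ 'n) set"
    assume F: "finite F"
    define B where "B = Max (insert 0 ((\<lambda>(k, i). \<bar>k $ i\<bar>) ` (F \<times> UNIV)))"
    have B: "\<bar>k $ i\<bar> \<le> B" if "k \<in> F" for k i
      unfolding B_def using F that by (intro Max_ge) force+
    have sub: "vec_nth ` F \<subseteq> PiE UNIV (\<lambda>_. {- B..B})"
    proof (clarsimp simp: PiE_iff)
      fix k i
      assume "k \<in> F"
      then show "- B \<le> k $ i \<and> k $ i \<le> B"
        using B[of k i] by linarith
    qed
    have "(\<Sum>k\<in>F. jap (real_vec k) powr - s) \<le> (\<Sum>k\<in>F. \<Prod>i\<in>UNIV. h (k $ i))"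
      by (intro sum_mono summand)
    also have "\<dots> = (\<Sum>g\<in>vec_nth ` F. \<Prod>i\<in>UNIV. h (g i))"
      by (subst sum.reindex) (auto simp: inj_on_def vec_nth_inject)
    also have "\<dots> \<le> (\<Sum>g\<in>PiE (UNIV :: 'n set) (\<lambda>_. {- B..B}). \<Prod>i\<in>UNIV. h (g i))"
    proof (rule sum_mono2[OF _ sub])
      show "finite (PiE (UNIV :: 'n set) (\<lambda>_. {- B..B}))"
        by (simp add: finite_PiE)
    qed (simp add: h0 prod_nonneg)
    also have "\<dots> = (\<Prod>i\<in>(UNIV :: 'n set). \<Sum>z = - B..B. h z)"
      by (subst prod_sum_PiE) auto
    also have "\<dots> \<le> (\<Prod>i\<in>(UNIV :: 'n set). Z)"
      using Z(2) h0 by (intro prod_mono) (auto intro: sum_nonneg)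
    finally show "(\<Sum>k\<in>F. jap (real_vec k) powr - s) \<le> Z ^ CARD('n)"
      by simp
  qed
qed

section \<open>Slabs\<close>

definition slab :: "real \<Rightarrow> 'a::euclidean_space \<Rightarrow> real \<Rightarrow> real \<Rightarrow> 'a set" where
  "slab r v s d = {x \<in> cball 0 r. \<bar>x \<bullet> v + s\<bar> \<le> d}"

lemma slab_lmeasurable: "slab r v s d \<in> lmeasurable"
proof -
  have "closed {x. \<bar>x \<bullet> v + s\<bar> \<le> d}"
    by (intro closed_Collect_le continuous_intros)
  then have "compact (cball 0 r \<inter> {x. \<bar>x \<bullet> v + s\<bar> \<le> d})"
    by (intro compact_Int_closed) auto
  then show ?thesis
    by (intro lmeasurable_compact) (simp add: slab_def Int_def)
qed

text \<open>Translates of the slab along its normal by different multiples of \<open>3 d / norm v\<close>, which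
  exceeds its width \<open>2 d / norm v\<close>, are disjoint, and at least \<open>r norm v / (3 d)\<close> of them stay in the
  ball of twice the radius. So translation invariance gives the linear dependence on \<open>d\<close>, without
  Fubini's theorem or a change of variables.\<close>

lemma measure_slab_le:
  fixes v :: "'a::euclidean_space"
  assumes "v \<noteq> 0" "0 < r" "0 < d"
  shows "measure lebesgue (slab r v s d) \<le> 3 * d / (r * norm v) * measure lebesgue (cball (0 :: 'a) (2 * r))"
proof -
  define w where "w = 3 * d / norm v"
  define u where "u = (1 / norm v) *\<^sub>R v"
  define L where "L = nat \<lfloor>r / w\<rfloor>"
  define T where "T = (\<lambda>i :: nat. (+) ((real i * w) *\<^sub>R u) ` slab r v s d)"
  have w: "0 < w" "w * norm v = 3 * d"
    using assms by (auto simp: w_def)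
  have u: "norm u = 1" "u \<bullet> v = norm v"
    using assms by (auto simp: u_def dot_square_norm power2_eq_square)
  have "0 \<le> r / w"
    using assms w by simp
  then have L: "real L \<le> r / w" "r / w \<le> real (Suc L)"
    unfolding L_def by linarith+
  have meas: "T i \<in> lmeasurable" for i
    unfolding T_def by (intro measurable_translation slab_lmeasurable)
  have "disjnt (T i) (T j)" if "i \<noteq> j" for i j
  proof (rule ccontr)
    assume "\<not> disjnt (T i) (T j)"
    then obtain x y where xy: "x \<in> slab r v s d" "y \<in> slab r v s d"
      "(real i * w) *\<^sub>R u + x = (real j * w) *\<^sub>R u + y"
      by (auto simp: T_def disjnt_iff)
    have "real i * (w * norm v) + x \<bullet> v = real j * (w * norm v) + y \<bullet> v"
      using arg_cong[OF xy(3), of "\<lambda>z. z \<bullet> v"] by (simp add: inner_add_left u)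
    then have eq: "(real i - real j) * (3 * d) = y \<bullet> v - x \<bullet> v"
      unfolding w(2) by (simp add: algebra_simps)
    have "\<bar>y \<bullet> v - x \<bullet> v\<bar> \<le> 2 * d"
      using xy(1,2) by (auto simp: slab_def)
    then have "\<bar>real i - real j\<bar> * (3 * d) \<le> 2 * d"
      using assms(3) by (simp flip: eq add: abs_mult)
    moreover have "1 * (3 * d) \<le> \<bar>real i - real j\<bar> * (3 * d)"
      using that assms(3) by (intro mult_right_mono) linarith+
    ultimately show False
      using assms(3) by linarith
  qed
  then have "(\<Sum>i\<le>L. measure lebesgue (T i)) = measure lebesgue (\<Union>i\<le>L. T i)"
    using meas by (intro measure_UNION'[symmetric]) (auto simp: pairwise_def)
  also have "\<dots> \<le> measure lebesgue (cball (0 :: 'a) (2 * r))"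
  proof (rule measure_mono_fmeasurable)
    show "(\<Union>i\<le>L. T i) \<subseteq> cball 0 (2 * r)"
    proof (clarsimp simp: T_def)
      fix i x
      assume i: "i \<le> L" and x: "x \<in> slab r v s d"
      have "real i * w \<le> r / w * w"
        using i L w by (intro mult_right_mono) linarith+
      then have "norm ((real i * w) *\<^sub>R u) \<le> r"
        using w u by simp
      moreover have "norm x \<le> r"
        using x by (simp add: slab_def)
      ultimately show "norm ((real i * w) *\<^sub>R u + x) \<le> 2 * r"
        using norm_triangle_ineq[of "(real i * w) *\<^sub>R u" x] by linarith
    qed
    show "(\<Union>i\<le>L. T i) \<in> sets lebesgue"
      using meas by (intro sets.finite_UN) auto
  qed simp
  finally have "real (Suc L) * measure lebesgue (slab r v s d) \<le> measure lebesgue (cball (0 :: 'a) (2 * r))"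
    by (simp add: T_def measure_translation)
  moreover have "r / w * measure lebesgue (slab r v s d) \<le> real (Suc L) * measure lebesgue (slab r v s d)"
    using L by (intro mult_right_mono) auto
  ultimately have "r / w * measure lebesgue (slab r v s d) \<le> measure lebesgue (cball (0 :: 'a) (2 * r))"
    by linarith
  then show ?thesis
    using assms w by (simp add: w_def field_simps)
qed

lemma annulus_eq: "0 < M \<Longrightarrow> annulus M = cball 0 (2 * M) - ball 0 M"
  by (simp add: annulus_def)

lemma annulus_lmeasurable:
  assumes "0 < M"
  shows "(annulus M :: (real ^ 'n) set) \<in> lmeasurable"
  unfolding annulus_eq[OF assms] by (intro fmeasurable_Diff) auto

lemma measure_annulus_ge:
  assumes "0 < M"
  shows "M ^ CARD('n) * measure lborel (ball (0 :: real ^ 'n) 1) \<le> measure lebesgue (annulus M :: (real ^ 'n) set)"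
proof -
  let ?V = "measure lborel (ball (0 :: real ^ 'n) 1)"
  have "measure lebesgue (annulus M :: (real ^ 'n) set) =
      measure lebesgue (cball (0 :: real ^ 'n) (2 * M)) - measure lebesgue (ball (0 :: real ^ 'n) M)"
    unfolding annulus_eq[OF assms] using assms by (intro measurable_measure_Diff) auto
  also have "\<dots> = measure lborel (ball (0 :: real ^ 'n) (2 * M)) - measure lborel (ball (0 :: real ^ 'n) M)"
    using content_cball_conv_ball[of "0 :: real ^ 'n" "2 * M"] by simp
  also have "\<dots> = (2 * M) ^ CARD('n) * ?V - M ^ CARD('n) * ?V"
    using assms by (simp only: content_ball_conv_unit_ball[of "2 * M"] content_ball_conv_unit_ball[of M]) simp
  also have "\<dots> = (2 ^ CARD('n) - 1) * (M ^ CARD('n) * ?V)"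
    by (simp add: power_mult_distrib algebra_simps)
  also have "\<dots> \<ge> 1 * (M ^ CARD('n) * ?V)"
  proof (rule mult_right_mono)
    have "(2 :: real) ^ 1 \<le> 2 ^ CARD('n)"
      by (intro power_increasing) (auto simp: Suc_le_eq)
    then show "1 \<le> (2 :: real) ^ CARD('n) - 1" by simp
  qed (use assms in auto)
  finally show ?thesis by simp
qed

lemma measure_annulus_pos:
  assumes "0 < M"
  shows "0 < measure lebesgue (annulus M :: (real ^ 'n) set)"
proof -
  have "0 < M ^ CARD('n) * measure lborel (ball (0 :: real ^ 'n) 1)"
    using assms content_ball_pos[of 1 "0 :: real ^ 'n"] by simp
  then show ?thesis
    using measure_annulus_ge[OF assms, where ?'n = 'n] by linarith
qed

lemma measure_slab_le_annulus:
  fixes v :: "real ^ 'n"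
  assumes "v \<noteq> 0" "0 < M" "0 < d"
  shows "measure lebesgue (slab (2 * M) v s d) \<le>
    2 * 4 ^ CARD('n) * (d / (M * norm v)) * measure lebesgue (annulus M :: (real ^ 'n) set)"
proof -
  let ?V = "measure lborel (ball (0 :: real ^ 'n) 1)"
  have "measure lebesgue (slab (2 * M) v s d) \<le>
      3 * d / (2 * M * norm v) * measure lebesgue (cball (0 :: real ^ 'n) (2 * (2 * M)))"
    using assms by (intro measure_slab_le) auto
  also have "measure lebesgue (cball (0 :: real ^ 'n) (2 * (2 * M))) = measure lborel (ball (0 :: real ^ 'n) (4 * M))"
    using content_cball_conv_ball[of "0 :: real ^ 'n" "4 * M"] by simp
  also have "\<dots> = 4 ^ CARD('n) * (M ^ CARD('n) * ?V)"
    using assms by (simp only: content_ball_conv_unit_ball[of "4 * M"]) (simp add: power_mult_distrib)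
  also have "3 * d / (2 * M * norm v) * (4 ^ CARD('n) * (M ^ CARD('n) * ?V)) \<le>
      3 * d / (2 * M * norm v) * (4 ^ CARD('n) * measure lebesgue (annulus M :: (real ^ 'n) set))"
    using assms by (intro mult_left_mono measure_annulus_ge) auto
  also have "\<dots> \<le> 2 * d / (M * norm v) * (4 ^ CARD('n) * measure lebesgue (annulus M :: (real ^ 'n) set))"
    using assms by (intro mult_right_mono) (auto simp: field_simps)
  finally show ?thesis
    by (simp add: mult_ac)
qed

lemma measure_UN_slab_le:
  fixes v :: "real ^ 'n"
  assumes "v \<noteq> 0" "0 < M" "0 < d" "finite T" "real (card T) \<le> b"
  shows "measure lebesgue (\<Union>s\<in>T. slab (2 * M) v s d) \<le>
    b * (2 * 4 ^ CARD('n) * (d / (M * norm v)) * measure lebesgue (annulus M :: (real ^ 'n) set))"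
proof -
  let ?c = "2 * 4 ^ CARD('n) * (d / (M * norm v)) * measure lebesgue (annulus M :: (real ^ 'n) set)"
  have "measure lebesgue (\<Union>s\<in>T. slab (2 * M) v s d) \<le> (\<Sum>s\<in>T. measure lebesgue (slab (2 * M) v s d))"
    using assms(4) by (intro measure_UNION_le) (auto intro: fmeasurableD slab_lmeasurable)
  also have "\<dots> \<le> (\<Sum>s\<in>T. ?c)"
    using assms by (intro sum_mono measure_slab_le_annulus)
  also have "\<dots> = real (card T) * ?c"
    by simp
  also have "\<dots> \<le> b * ?c"
    using assms by (intro mult_right_mono) auto
  finally show ?thesis .
qed

section \<open>Sets of resonant frequencies\<close>

text \<open>The product of the difference and the sum of the two frequencies is
  \<open>j\<^sup>2 - l\<^sup>2\<close>, as it is for \<open>m = 0\<close>, and the sum grows at most by the factor \<open>1 + m\<close>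
  because \<open>j + l \<ge> 2\<close>.\<close>

lemma freq_diff_ge:
  assumes "0 \<le> m" "1 \<le> j" "1 \<le> l"
  shows "\<bar>real j - real l\<bar> / (1 + m) \<le> \<bar>freq m j - freq m l\<bar>"
proof -
  let ?f = "freq m j + freq m l"
  have "(freq m j - freq m l) * ?f = (real j - real l) * (real j + real l)"
    by (simp add: freq_def algebra_simps flip: power2_eq_square)
  then have "\<bar>freq m j - freq m l\<bar> * \<bar>?f\<bar> = \<bar>real j - real l\<bar> * \<bar>real j + real l\<bar>"
    by (metis abs_mult)
  moreover have "0 \<le> ?f"
    by (simp add: freq_def)
  ultimately have eq: "\<bar>freq m j - freq m l\<bar> * ?f = \<bar>real j - real l\<bar> * (real j + real l)"
    by simp
  have "?f \<le> (real j + real l) + m * 2"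
    using freq_le_add[OF assms(1), of j] freq_le_add[OF assms(1), of l] by simp
  also have "m * 2 \<le> m * (real j + real l)"
    using assms by (intro mult_left_mono) auto
  finally have "\<bar>freq m j - freq m l\<bar> * ?f \<le> \<bar>freq m j - freq m l\<bar> * ((1 + m) * (real j + real l))"
    by (intro mult_left_mono) (auto simp: algebra_simps)
  then have "\<bar>real j - real l\<bar> * (real j + real l) \<le> (\<bar>freq m j - freq m l\<bar> * (1 + m)) * (real j + real l)"
    unfolding eq by (simp add: mult_ac)
  then have "\<bar>real j - real l\<bar> \<le> \<bar>freq m j - freq m l\<bar> * (1 + m)"
    by (rule mult_right_le_imp_le) (use assms in auto)
  then show ?thesis
    using assms by (simp add: field_simps)
qed

lemma weight_le:
  fixes x :: real
  assumes "0 \<le> \<alpha>" "\<alpha> \<le> 1" "0 < M" "jap x / M \<le> W" "1 \<le> W"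
  shows "jap x powr \<alpha> / M powr \<alpha> \<le> W"
proof -
  have "jap x powr \<alpha> / M powr \<alpha> = (jap x / M) powr \<alpha>"
    using assms jap_ge_1[of x] by (simp add: powr_divide)
  also have "\<dots> \<le> W powr \<alpha>"
    using assms jap_ge_1[of x] by (intro powr_mono2) auto
  also have "\<dots> \<le> W powr 1"
    using assms by (intro powr_mono) auto
  finally show ?thesis
    using assms by simp
qed

lemma weight_le_1_plus_abs:
  fixes x :: real
  assumes "0 \<le> \<alpha>" "\<alpha> \<le> 1" "1 \<le> M"
  shows "jap x powr \<alpha> / M powr \<alpha> \<le> 1 + \<bar>x\<bar>"
proof (rule weight_le)
  have "jap x / M \<le> jap x / 1"
    using assms jap_ge_1[of x] by (intro divide_left_mono) auto
  then show "jap x / M \<le> 1 + \<bar>x\<bar>"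
    using jap_le_1_plus_norm[of x] by simp
qed (use assms in auto)

text \<open>The role of \<open>x\<close> is played by \<open>\<omega> \<bullet> k\<close> and that of \<open>X\<close> by \<open>M |k|\<close>. The factor \<open>1 / 8\<close>, coming
  from \<open>\<gamma> \<le> 1 / 8\<close>, lets the index \<open>j + \<sigma> l\<close> on the right be absorbed on the left.\<close>

lemma resonance_index_bound:
  fixes \<sigma> :: int
  assumes "0 \<le> m" "1 \<le> X" "\<bar>x\<bar> \<le> 2 * X" "\<sigma> \<in> {1, -1}"
    and "\<bar>x + freq m j + \<sigma> * freq m l\<bar> \<le> (1 + \<bar>real j + \<sigma> * real l\<bar>) / 8"
  shows "\<bar>real j + \<sigma> * real l\<bar> \<le> (3 * m + 3) * X"
proof -
  have "\<bar>real j + \<sigma> * real l\<bar> \<le> \<bar>freq m j + \<sigma> * freq m l\<bar> + 2 * m"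
    using assms(1,4) freq_ge[of j m] freq_ge[of l m] freq_le_add[OF assms(1), of j] freq_le_add[OF assms(1), of l]
    by auto
  moreover have "\<bar>freq m j + \<sigma> * freq m l\<bar> \<le> \<bar>x + freq m j + \<sigma> * freq m l\<bar> + \<bar>x\<bar>"
    by linarith
  moreover have "m * 1 \<le> m * X"
    using assms by (intro mult_left_mono)
  ultimately show ?thesis
    using assms(1,2,3,5) by (simp add: algebra_simps)
qed

lemma resonance_near_integer:
  fixes \<sigma> :: int
  assumes "\<sigma> \<in> {1, -1}" "0 < J" "J \<le> real j" "J \<le> real l"
  shows "\<bar>(freq m j + \<sigma> * freq m l) - (real j + \<sigma> * real l)\<bar> \<le> 2 * m\<^sup>2 / J"
proof -
  have near: "\<bar>freq m i - real i\<bar> \<le> m\<^sup>2 / J" if "J \<le> real i" for i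
  proof -
    have "0 < i"
      using that assms(2) by (cases i) auto
    then have "freq m i - real i \<le> m\<^sup>2 / real i"
      using freq_le_add_inverse[of i m] by simp
    also have "\<dots> \<le> m\<^sup>2 / J"
      using that assms(2) by (intro divide_left_mono) auto
    finally show ?thesis
      using freq_ge[of i m] by simp
  qed
  show ?thesis
    using assms(1) near[OF assms(3)] near[OF assms(4)] by auto
qed

text \<open>Both sign choices are packed into \<open>\<sigma>\<close>. For \<open>k = 0\<close> the set also takes in the resonances
  \<open>freq m a - freq m a = 0\<close>, so it is meant for \<open>k \<noteq> 0\<close> only.\<close>

definition resonant_set ::
  "real \<Rightarrow> real \<Rightarrow> real \<Rightarrow> real \<Rightarrow> real \<Rightarrow> int ^ 'n \<Rightarrow> (real ^ 'n) set" where
  "resonant_set m \<alpha> \<gamma> \<tau> M k = {\<omega> \<in> annulus M.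
     \<exists>j\<ge>1. \<exists>l\<ge>1. \<exists>\<sigma>\<in>{1, -1 :: int}. \<bar>\<omega> \<bullet> real_vec k + freq m j + \<sigma> * freq m l\<bar>
       < \<gamma> / jap (real_vec k) powr \<tau> * (jap (real j + \<sigma> * real l) powr \<alpha> / M powr \<alpha>)}"

text \<open>Contains the values of \<open>freq m j + \<sigma> freq m l\<close> with \<open>min j l \<le> J\<close> and
  \<open>\<bar>j + \<sigma> l\<bar> \<le> P\<close>, written in terms of \<open>p = j + \<sigma> l\<close> and an index \<open>q \<le> J\<close>, so that they
  can be counted; the flag \<open>b\<close> says whether \<open>q\<close> is \<open>l\<close> or \<open>j\<close>.\<close>

definition low_mode_centres :: "real \<Rightarrow> int \<Rightarrow> nat \<Rightarrow> real set" where
  "low_mode_centres m P J = (\<lambda>(b, \<sigma>, p, q).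
      if b then freq m (nat \<bar>p - \<sigma> * int q\<bar>) + of_int \<sigma> * freq m q
      else freq m q + of_int \<sigma> * freq m (nat \<bar>p - int q\<bar>))
    ` (UNIV \<times> {1, -1} \<times> {- P..P} \<times> {1..J})"

lemma finite_low_mode_centres: "finite (low_mode_centres m P J)"
  by (simp add: low_mode_centres_def)

lemma card_low_mode_centres:
  assumes "0 \<le> P"
  shows "real (card (low_mode_centres m P J)) \<le> 4 * (2 * real_of_int P + 1) * real J"
proof -
  have "card (low_mode_centres m P J) \<le> card ((UNIV :: bool set) \<times> {1, -1 :: int} \<times> {- P..P} \<times> {1..J})"
    unfolding low_mode_centres_def by (intro card_image_le) simp
  also have "\<dots> = 4 * (nat (2 * P + 1) * J)"
    by (simp add: card_cartesian_product card_insert_if)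
  finally have "real (card (low_mode_centres m P J)) \<le> real (4 * (nat (2 * P + 1) * J))"
    by (rule of_nat_mono)
  then show ?thesis
    using assms by (simp add: algebra_simps)
qed

lemma low_mode_centresI:
  fixes \<sigma> :: int
  assumes "\<sigma> \<in> {1, -1}" "1 \<le> j" "1 \<le> l" "j \<le> J \<or> l \<le> J" "\<bar>int j + \<sigma> * int l\<bar> \<le> P"
  shows "freq m j + \<sigma> * freq m l \<in> low_mode_centres m P J"
  using assms(4)
proof
  assume "l \<le> J"
  then show ?thesis
    unfolding low_mode_centres_def using assms
    by (intro image_eqI[of _ _ "(True, \<sigma>, int j + \<sigma> * int l, l)"]) auto
next
  assume "j \<le> J"
  then show ?thesis
    unfolding low_mode_centres_def using assms
    by (intro image_eqI[of _ _ "(False, \<sigma>, int j + \<sigma> * int l, j)"]) auto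
qed

text \<open>Large modes are caught by the slabs around integers, the remaining ones by slabs around the
  exact values. That \<open>\<delta>\<close> bounds the resonance width uniformly in \<open>j, l\<close> rests on the index bound
  \<open>|p| \<le> P\<close>: it gives \<open>jap p / M \<le> (3 m + 4) \<kappa>\<close>, and since the right side is at least \<open>1\<close> the
  power \<open>\<alpha> \<le> 1\<close> of the left side obeys the same bound.\<close>

lemma resonant_set_subset_slabs:
  fixes k :: "int ^ 'n"
  assumes "0 \<le> m" "0 \<le> \<alpha>" "\<alpha> \<le> 1" "0 \<le> \<tau>" "0 < \<gamma>" "\<gamma> \<le> 1 / 8" "1 < M" "k \<noteq> 0" "1 \<le> J"
  defines "\<kappa> \<equiv> jap (real_vec k)"
  defines "P \<equiv> \<lfloor>(3 * m + 3) * (M * norm (real_vec k))\<rfloor>"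
  defines "\<delta> \<equiv> \<gamma> / \<kappa> powr \<tau> * ((3 * m + 4) * \<kappa>)"
  shows "resonant_set m \<alpha> \<gamma> \<tau> M k \<subseteq>
    (\<Union>s\<in>real_of_int ` {- P..P}. slab (2 * M) (real_vec k) s (\<delta> + 2 * m\<^sup>2 / J)) \<union>
    (\<Union>s\<in>low_mode_centres m P (nat \<lfloor>J\<rfloor>). slab (2 * M) (real_vec k) s \<delta>)"
proof
  fix \<omega> :: "real ^ 'n"
  assume "\<omega> \<in> resonant_set m \<alpha> \<gamma> \<tau> M k"
  then obtain j l \<sigma> where \<omega>: "\<omega> \<in> annulus M" and jl: "1 \<le> j" "1 \<le> l" and \<sigma>: "\<sigma> \<in> {1, -1 :: int}"
    and small: "\<bar>\<omega> \<bullet> real_vec k + freq m j + \<sigma> * freq m l\<bar>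
       < \<gamma> / \<kappa> powr \<tau> * (jap (real j + \<sigma> * real l) powr \<alpha> / M powr \<alpha>)"
    unfolding resonant_set_def \<kappa>_def by blast
  define p where "p = int j + \<sigma> * int l"
  define s where "s = freq m j + \<sigma> * freq m l"
  have p: "real j + \<sigma> * real l = real_of_int p"
    by (simp add: p_def)
  have n1: "1 \<le> norm (real_vec k)"
    by (rule norm_real_vec_ge_1[OF assms(8)])
  have X: "1 \<le> M * norm (real_vec k)"
    using n1 assms(7) mult_mono[of 1 M 1 "norm (real_vec k)"] by simp
  have \<kappa>: "1 \<le> \<kappa>" "norm (real_vec k) \<le> \<kappa>"
    by (auto simp: \<kappa>_def jap_ge_1 norm_le_jap)
  have \<omega>': "\<omega> \<in> cball 0 (2 * M)"
    using \<omega> assms(7) by (simp add: annulus_eq)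
  have \<gamma>: "\<gamma> / \<kappa> powr \<tau> \<le> 1 / 8" "0 \<le> \<gamma> / \<kappa> powr \<tau>"
  proof -
    have "\<gamma> / \<kappa> powr \<tau> \<le> \<gamma> / 1"
      using assms \<kappa> by (intro divide_left_mono) (auto simp: ge_one_powr_ge_zero)
    then show "\<gamma> / \<kappa> powr \<tau> \<le> 1 / 8"
      using assms(6) by linarith
    show "0 \<le> \<gamma> / \<kappa> powr \<tau>"
      using assms(5) by simp
  qed
  have "\<bar>real j + \<sigma> * real l\<bar> \<le> (3 * m + 3) * (M * norm (real_vec k))"
  proof (rule resonance_index_bound[OF assms(1) X _ \<sigma>])
    have "\<bar>\<omega> \<bullet> real_vec k\<bar> \<le> norm \<omega> * norm (real_vec k)"
      by (rule Cauchy_Schwarz_ineq2)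
    also have "\<dots> \<le> 2 * M * norm (real_vec k)"
      using \<omega>' by (intro mult_right_mono) auto
    finally show "\<bar>\<omega> \<bullet> real_vec k\<bar> \<le> 2 * (M * norm (real_vec k))"
      by simp
    have "\<gamma> / \<kappa> powr \<tau> * (jap (real j + \<sigma> * real l) powr \<alpha> / M powr \<alpha>)
        \<le> 1 / 8 * (1 + \<bar>real j + \<sigma> * real l\<bar>)"
      using assms \<gamma> by (intro mult_mono weight_le_1_plus_abs) auto
    then show "\<bar>\<omega> \<bullet> real_vec k + freq m j + \<sigma> * freq m l\<bar> \<le> (1 + \<bar>real j + \<sigma> * real l\<bar>) / 8"
      using small by linarith
  qed
  then have p_le: "\<bar>real_of_int p\<bar> \<le> (3 * m + 3) * (M * norm (real_vec k))"
    by (simp only: p)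
  then have P: "\<bar>p\<bar> \<le> P"
    unfolding P_def by (simp add: le_floor_iff)
  have "jap (real_of_int p) / M \<le> (1 + (3 * m + 3) * (M * norm (real_vec k))) / M"
    using p_le jap_le_1_plus_norm[of "real_of_int p"] assms(7) by (intro divide_right_mono) auto
  also have "\<dots> = 1 / M + (3 * m + 3) * norm (real_vec k)"
    using assms(7) by (simp add: field_simps)
  also have "\<dots> \<le> \<kappa> + (3 * m + 3) * \<kappa>"
  proof (intro add_mono mult_left_mono)
    have "1 / M \<le> 1"
      using assms(7) by simp
    then show "1 / M \<le> \<kappa>"
      using \<kappa> by linarith
  qed (use assms(1) \<kappa> in auto)
  finally have "jap (real_of_int p) / M \<le> (3 * m + 4) * \<kappa>"
    by (simp add: algebra_simps)
  moreover have "1 \<le> (3 * m + 4) * \<kappa>"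
    using assms(1) \<kappa> mult_mono[of 1 "3 * m + 4" 1 \<kappa>] by simp
  ultimately have "jap (real_of_int p) powr \<alpha> / M powr \<alpha> \<le> (3 * m + 4) * \<kappa>"
    using assms by (intro weight_le) auto
  then have "\<gamma> / \<kappa> powr \<tau> * (jap (real_of_int p) powr \<alpha> / M powr \<alpha>) \<le> \<delta>"
    unfolding \<delta>_def using \<gamma> by (intro mult_left_mono)
  then have close: "\<bar>\<omega> \<bullet> real_vec k + s\<bar> \<le> \<delta>"
    using small unfolding p s_def by linarith
  show "\<omega> \<in> (\<Union>s\<in>real_of_int ` {- P..P}. slab (2 * M) (real_vec k) s (\<delta> + 2 * m\<^sup>2 / J)) \<union>
    (\<Union>s\<in>low_mode_centres m P (nat \<lfloor>J\<rfloor>). slab (2 * M) (real_vec k) s \<delta>)"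
  proof (cases "j \<le> nat \<lfloor>J\<rfloor> \<or> l \<le> nat \<lfloor>J\<rfloor>")
    case True
    then have "s \<in> low_mode_centres m P (nat \<lfloor>J\<rfloor>)"
      unfolding s_def using \<sigma> jl P by (intro low_mode_centresI) (auto simp: p_def)
    then show ?thesis
      using close \<omega>' by (auto simp: slab_def)
  next
    case False
    then have "J \<le> real j" "J \<le> real l"
      by linarith+
    then have "\<bar>s - real_of_int p\<bar> \<le> 2 * m\<^sup>2 / J"
      using resonance_near_integer[OF \<sigma>, of J j l m] assms(9) by (simp add: s_def p)
    then have "\<bar>\<omega> \<bullet> real_vec k + real_of_int p\<bar> \<le> \<delta> + 2 * m\<^sup>2 / J"
      using close by linarith
    then have "\<omega> \<in> slab (2 * M) (real_vec k) (real_of_int p) (\<delta> + 2 * m\<^sup>2 / J)"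
      using \<omega>' by (simp add: slab_def)
    moreover have "p \<in> {- P..P}"
      using P by auto
    ultimately show ?thesis
      by blast
  qed
qed

text \<open>The threshold \<open>J = 1 / g\<close> balances the two families of slabs: the error \<open>1 / J\<close> of the first is
  \<open>g\<close>, while the multiplicity \<open>J\<close> turns \<open>\<delta> = O(g\<^sup>2)\<close> into \<open>O(g)\<close> for the second. Passing to a
  covering set \<open>D\<close> avoids the measurability of the resonant set.\<close>

lemma resonant_set_cover:
  fixes k :: "int ^ 'n"
  assumes "0 \<le> m" "0 \<le> \<alpha>" "\<alpha> \<le> 1" "2 * real CARD('n) + 3 \<le> \<tau>" "0 < \<gamma>" "\<gamma> \<le> 1 / 8" "1 < M" "k \<noteq> 0"
  defines "C \<equiv> (3 * m + 3) * (6 * 4 ^ CARD('n)) * (5 * (3 * m + 4) + 2 * m\<^sup>2)"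
  obtains D where "resonant_set m \<alpha> \<gamma> \<tau> M k \<subseteq> D" "D \<in> lmeasurable"
    "measure lebesgue D \<le> C * (\<gamma> powr (1 / 2) * jap (real_vec k) powr - (real CARD('n) + 1))
       * measure lebesgue (annulus M :: (real ^ 'n) set)"
proof
  define \<kappa> where "\<kappa> = jap (real_vec k)"
  define v where "v = real_vec k"
  define K where "K = 3 * m + 3"
  define X where "X = M * norm v"
  define P where "P = \<lfloor>K * X\<rfloor>"
  define g where "g = \<gamma> powr (1 / 2) * \<kappa> powr - (real CARD('n) + 1)"
  define J where "J = 1 / g"
  define \<delta> where "\<delta> = \<gamma> / \<kappa> powr \<tau> * ((3 * m + 4) * \<kappa>)"
  define \<mu> where "\<mu> = measure lebesgue (annulus M :: (real ^ 'n) set)"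
  define D1 where "D1 = (\<Union>s\<in>real_of_int ` {- P..P}. slab (2 * M) v s (\<delta> + 2 * m\<^sup>2 / J))"
  define D2 where "D2 = (\<Union>s\<in>low_mode_centres m P (nat \<lfloor>J\<rfloor>). slab (2 * M) v s \<delta>)"
  have \<kappa>: "1 \<le> \<kappa>"
    by (simp add: \<kappa>_def jap_ge_1)
  have n1: "1 \<le> norm v"
    unfolding v_def by (rule norm_real_vec_ge_1[OF assms(8)])
  have v: "v \<noteq> 0"
    using n1 by auto
  have X: "1 \<le> X"
    using n1 assms(7) mult_mono[of 1 M 1 "norm v"] by (simp add: X_def)
  have K: "3 \<le> K"
    using assms(1) by (simp add: K_def)
  have KX: "3 \<le> K * X"
    using K X mult_mono[of 3 K 1 X] by simp
  have P: "0 \<le> P" "2 * real_of_int P + 1 \<le> 3 * (K * X)"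
    using KX unfolding P_def by linarith+
  have "\<gamma> powr (1 / 2) \<le> 1"
    using assms(5,6) by (intro powr_le1) auto
  moreover have "\<kappa> powr - (real CARD('n) + 1) \<le> \<kappa> powr 0"
    using \<kappa> by (intro powr_mono) auto
  ultimately have g: "0 < g" "g \<le> 1"
    using assms(5) \<kappa> mult_mono[of "\<gamma> powr (1/2)" 1 "\<kappa> powr - (real CARD('n) + 1)" 1] by (auto simp: g_def)
  then have J: "1 \<le> J"
    by (simp add: J_def)
  have \<delta>0: "0 < \<delta>"
    using assms \<kappa> by (auto simp: \<delta>_def intro!: mult_pos_pos divide_pos_pos add_nonneg_pos)
  \<comment> \<open>The exponent \<open>1 - \<tau>\<close> is at most \<open>- 2 (n + 1)\<close>, twice the exponent of \<open>\<kappa>\<close> in \<open>g\<close>.\<close>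
  have "\<delta> = (3 * m + 4) * (\<gamma> powr 1 * \<kappa> powr (1 - \<tau>))"
    using assms(5) \<kappa> by (simp add: \<delta>_def powr_diff)
  also have "\<dots> \<le> (3 * m + 4) * (\<gamma> powr 1 * \<kappa> powr - (2 * real CARD('n) + 2))"
    using assms \<kappa> by (intro mult_left_mono powr_mono) auto
  also have "\<gamma> powr 1 * \<kappa> powr - (2 * real CARD('n) + 2) = g\<^sup>2"
    using assms(5) \<kappa> by (simp add: g_def power_mult_distrib powr_power algebra_simps)
  finally have \<delta>: "\<delta> \<le> (3 * m + 4) * g\<^sup>2" .
  have \<mu>: "0 \<le> \<mu>"
    by (simp add: \<mu>_def)
  have "measure lebesgue D1 \<le> 3 * (K * X) * (2 * 4 ^ CARD('n) * ((\<delta> + 2 * m\<^sup>2 / J) / X) * \<mu>)"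
    unfolding D1_def X_def \<mu>_def
  proof (rule measure_UN_slab_le[OF v])
    have "real (card (real_of_int ` {- P..P})) = 2 * real_of_int P + 1"
      using P by (subst card_image) (auto simp: inj_on_def)
    then show "real (card (real_of_int ` {- P..P})) \<le> 3 * (K * (M * norm v))"
      using P by (simp add: X_def)
  qed (use assms \<delta>0 J in \<open>auto intro!: add_pos_nonneg\<close>)
  also have "\<dots> = K * (6 * 4 ^ CARD('n)) * (\<delta> + 2 * m\<^sup>2 * g) * \<mu>"
    using X by (simp add: J_def)
  also have "\<dots> \<le> K * (6 * 4 ^ CARD('n)) * (((3 * m + 4) + 2 * m\<^sup>2) * g) * \<mu>"
  proof -
    have "g\<^sup>2 \<le> g"
      using g by (simp add: power2_eq_square mult_left_le)
    then have "\<delta> \<le> (3 * m + 4) * g"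
      using \<delta> mult_left_mono[of "g\<^sup>2" g "3 * m + 4"] assms(1) by linarith
    then show ?thesis
      using K \<mu> by (intro mult_right_mono mult_left_mono) (auto simp: algebra_simps)
  qed
  finally have D1: "measure lebesgue D1 \<le> K * (6 * 4 ^ CARD('n)) * (((3 * m + 4) + 2 * m\<^sup>2) * g) * \<mu>" .
  have "measure lebesgue D2 \<le> 4 * (3 * (K * X)) * J * (2 * 4 ^ CARD('n) * (\<delta> / X) * \<mu>)"
    unfolding D2_def X_def \<mu>_def
  proof (rule measure_UN_slab_le[OF v])
    have "real (card (low_mode_centres m P (nat \<lfloor>J\<rfloor>))) \<le> 4 * (2 * real_of_int P + 1) * real (nat \<lfloor>J\<rfloor>)"
      by (rule card_low_mode_centres[OF P(1)])
    also have "\<dots> \<le> 4 * (3 * (K * X)) * J"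
      using P J KX by (intro mult_mono) auto
    finally show "real (card (low_mode_centres m P (nat \<lfloor>J\<rfloor>))) \<le> 4 * (3 * (K * (M * norm v))) * J"
      by (simp add: X_def)
  qed (use assms \<delta>0 finite_low_mode_centres in auto)
  also have "\<dots> = K * (6 * 4 ^ CARD('n)) * (4 * (J * \<delta>)) * \<mu>"
    using X by simp
  also have "\<dots> \<le> K * (6 * 4 ^ CARD('n)) * (4 * ((3 * m + 4) * g)) * \<mu>"
  proof -
    have "J * \<delta> \<le> J * ((3 * m + 4) * g\<^sup>2)"
      using \<delta> J by (intro mult_left_mono) auto
    then have "J * \<delta> \<le> (3 * m + 4) * g"
      using g by (simp add: J_def power2_eq_square)
    then show ?thesis
      using K \<mu> by (intro mult_right_mono mult_left_mono) auto
  qed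
  finally have D2: "measure lebesgue D2 \<le> K * (6 * 4 ^ CARD('n)) * (4 * ((3 * m + 4) * g)) * \<mu>" .
  have meas: "D1 \<in> lmeasurable" "D2 \<in> lmeasurable"
    unfolding D1_def D2_def by (intro fmeasurable.finite_UN; simp add: slab_lmeasurable finite_low_mode_centres)+
  show "resonant_set m \<alpha> \<gamma> \<tau> M k \<subseteq> D1 \<union> D2"
    unfolding D1_def D2_def \<delta>_def P_def X_def K_def v_def \<kappa>_def
    using assms J by (intro resonant_set_subset_slabs) auto
  show "D1 \<union> D2 \<in> lmeasurable"
    using meas by (rule fmeasurable.Un)
  have "measure lebesgue (D1 \<union> D2) \<le> measure lebesgue D1 + measure lebesgue D2"
    using meas by (intro measure_Un_le) auto
  also have "\<dots> \<le> K * (6 * 4 ^ CARD('n)) * (((3 * m + 4) + 2 * m\<^sup>2) * g) * \<mu>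
      + K * (6 * 4 ^ CARD('n)) * (4 * ((3 * m + 4) * g)) * \<mu>"
    by (rule add_mono[OF D1 D2])
  also have "\<dots> = C * g * \<mu>"
    by (simp add: C_def K_def algebra_simps)
  finally show "measure lebesgue (D1 \<union> D2) \<le> C * (\<gamma> powr (1 / 2) * jap (real_vec k) powr - (real CARD('n) + 1))
       * measure lebesgue (annulus M :: (real ^ 'n) set)"
    by (simp add: g_def \<kappa>_def \<mu>_def)
qed

text \<open>For \<open>k = 0\<close> the conditions do not involve \<open>\<omega>\<close> and hold when \<open>\<gamma>\<close> is small: the sum of two
  frequencies is at least \<open>j + l\<close>, and their difference is at least \<open>|j - l| / (1 + m)\<close>
  with \<open>|j - l| \<ge> 1\<close>.\<close>

lemma Omega0_diff_U_set_subset: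
  assumes "0 \<le> m" "0 \<le> \<alpha>" "\<alpha> \<le> 1" "0 < \<gamma>" "\<gamma> \<le> 1 / 8" "\<gamma> \<le> 1 / (2 * (1 + m))" "1 < M"
  shows "Omega0 \<gamma>0 \<tau>0 M - U_set m \<gamma>0 \<tau>0 \<alpha> \<gamma> \<tau> M
    \<subseteq> (\<Union>k\<in>- {0 :: int ^ 'n}. resonant_set m \<alpha> \<gamma> \<tau> M k)"
proof
  fix \<omega> :: "real ^ 'n"
  assume \<omega>: "\<omega> \<in> Omega0 \<gamma>0 \<tau>0 M - U_set m \<gamma>0 \<tau>0 \<alpha> \<gamma> \<tau> M"
  then have ann: "\<omega> \<in> annulus M"
    by (simp add: Omega0_def)
  have weight: "\<gamma> / jap (real_vec (0 :: int ^ 'n)) powr \<tau> * (jap x powr \<alpha> / M powr \<alpha>) \<le> \<gamma> * (1 + \<bar>x\<bar>)" for x :: real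
  proof -
    have "jap (real_vec (0 :: int ^ 'n)) = 1"
      by (simp add: jap_def real_vec_def zero_vec_def[symmetric])
    moreover have "\<gamma> * (jap x powr \<alpha> / M powr \<alpha>) \<le> \<gamma> * (1 + \<bar>x\<bar>)"
      using assms by (intro mult_left_mono weight_le_1_plus_abs) auto
    ultimately show ?thesis
      by simp
  qed
  obtain j l \<sigma> k where jl: "1 \<le> j" "1 \<le> l" and \<sigma>: "\<sigma> \<in> {1, -1 :: int}"
    and ne: "\<sigma> = - 1 \<and> k = 0 \<longrightarrow> j \<noteq> l"
    and small: "\<bar>\<omega> \<bullet> real_vec k + freq m j + \<sigma> * freq m l\<bar>
       < \<gamma> / jap (real_vec k) powr \<tau> * (jap (real j + \<sigma> * real l) powr \<alpha> / M powr \<alpha>)"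
  proof -
    from \<omega> consider
        (plus) k j l where "(k, j, l) \<in> index_plus" "\<bar>\<omega> \<bullet> real_vec k + freq m j + freq m l\<bar>
            < \<gamma> / jap (real_vec k) powr \<tau> * (jap (real j + real l) powr \<alpha> / M powr \<alpha>)"
      | (minus) k j l where "(k, j, l) \<in> index_minus" "\<bar>\<omega> \<bullet> real_vec k + freq m j - freq m l\<bar>
            < \<gamma> / jap (real_vec k) powr \<tau> * (jap (real j - real l) powr \<alpha> / M powr \<alpha>)"
      unfolding U_set_def by (force simp: not_le)
    then show thesis
    proof cases
      case plus
      then show thesis
        using that[of j l 1 k] by (auto simp: index_plus_def)
    next
      case minus
      then show thesis
        using that[of j l "-1" k] by (auto simp: index_minus_def index_plus_def)
    qed
  qed
  have "k \<noteq> 0"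
  proof
    assume k: "k = 0"
    then have "\<bar>freq m j + \<sigma> * freq m l\<bar> < \<gamma> / jap (real_vec (0 :: int ^ 'n)) powr \<tau> * (jap (real j + \<sigma> * real l) powr \<alpha> / M powr \<alpha>)"
      using small by (simp add: real_vec_def zero_vec_def[symmetric])
    then have less: "\<bar>freq m j + \<sigma> * freq m l\<bar> < \<gamma> * (1 + \<bar>real j + \<sigma> * real l\<bar>)"
      using weight[of "real j + \<sigma> * real l"] by linarith
    show False
    proof (cases "\<sigma> = 1")
      case True
      have "freq m j + freq m l < \<gamma> * (1 + (real j + real l))"
        using less True by simp
      also have "\<dots> \<le> 1 / 8 * (1 + (real j + real l))"
        using assms by (intro mult_right_mono) auto
      finally have "freq m j + freq m l < 1 / 8 * (1 + (real j + real l))" .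
      moreover have "1 \<le> real j" "1 \<le> real l"
        using jl by simp_all
      ultimately show False
        using freq_ge[of j m] freq_ge[of l m] by simp
    next
      case False
      then have s: "\<sigma> = -1"
        using \<sigma> by auto
      then have "1 \<le> \<bar>real j - real l\<bar>"
        using ne k by linarith
      then have "\<gamma> * (1 + \<bar>real j - real l\<bar>) \<le> \<gamma> * (2 * \<bar>real j - real l\<bar>)"
        using assms by (intro mult_left_mono) auto
      also have "\<dots> \<le> 1 / (2 * (1 + m)) * (2 * \<bar>real j - real l\<bar>)"
        using assms by (intro mult_right_mono) auto
      also have "\<dots> = \<bar>real j - real l\<bar> / (1 + m)"
        using assms by (simp add: field_simps)
      also have "\<dots> \<le> \<bar>freq m j - freq m l\<bar>"
        using assms jl by (intro freq_diff_ge)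
      finally show False
        using less s by simp
    qed
  qed
  moreover have "\<omega> \<in> resonant_set m \<alpha> \<gamma> \<tau> M k"
    unfolding resonant_set_def using ann jl \<sigma> small by blast
  ultimately show "\<omega> \<in> (\<Union>k\<in>- {0 :: int ^ 'n}. resonant_set m \<alpha> \<gamma> \<tau> M k)"
    by blast
qed

section \<open>The measure estimate\<close>

text \<open>Also for sets that are not measurable, whose \<open>measure\<close> is \<open>0\<close> by convention.\<close>

lemma measure_le_of_subset:
  assumes "A \<subseteq> B" "B \<in> fmeasurable N"
  shows "measure N A \<le> measure N B"
  using assms by (cases "A \<in> sets N") (auto intro: measure_mono_fmeasurable simp: measure_notin_sets)

lemma measure_UN_resonant_set_le:
  assumes "0 \<le> m" "0 \<le> \<alpha>" "\<alpha> \<le> 1" "2 * real CARD('n::finite) + 3 \<le> \<tau>"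
  obtains C where "0 < C"
    "\<And>A M \<gamma>. \<lbrakk>1 < M; 0 < \<gamma>; \<gamma> \<le> 1 / 8; A \<subseteq> (\<Union>k\<in>- {0 :: int ^ 'n}. resonant_set m \<alpha> \<gamma> \<tau> M k)\<rbrakk>
      \<Longrightarrow> rel_measure M A \<le> C * \<gamma> powr (1 / 2)"
proof -
  define c where "c = (3 * m + 3) * (6 * 4 ^ CARD('n)) * (5 * (3 * m + 4) + 2 * m\<^sup>2)"
  have c: "0 < c"
    unfolding c_def using assms(1) by (intro mult_pos_pos add_pos_nonneg add_nonneg_pos) auto
  obtain S where S: "0 < S"
    "\<And>F :: (int ^ 'n) set. finite F \<Longrightarrow> (\<Sum>k\<in>F. jap (real_vec k) powr - (real CARD('n) + 1)) \<le> S"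
    using lattice_sum_bounded[of "real CARD('n) + 1", where ?'n = 'n] by auto
  show thesis
  proof
    show "0 < c * S"
      using c S by simp
    fix A :: "(real ^ 'n) set" and M \<gamma> :: real
    assume M: "1 < M" and \<gamma>: "0 < \<gamma>" "\<gamma> \<le> 1 / 8"
      and A: "A \<subseteq> (\<Union>k\<in>- {0 :: int ^ 'n}. resonant_set m \<alpha> \<gamma> \<tau> M k)"
    define \<mu> where "\<mu> = measure lebesgue (annulus M :: (real ^ 'n) set)"
    have \<mu>: "0 < \<mu>"
      unfolding \<mu>_def using M by (intro measure_annulus_pos) simp
    have "\<exists>D. resonant_set m \<alpha> \<gamma> \<tau> M k \<subseteq> D \<and> D \<in> lmeasurable \<and>
        measure lebesgue D \<le> c * (\<gamma> powr (1 / 2) * jap (real_vec k) powr - (real CARD('n) + 1)) * \<mu>"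
      if "k \<noteq> 0" for k :: "int ^ 'n"
      using resonant_set_cover[OF assms \<gamma> M that] unfolding c_def \<mu>_def by metis
    then obtain D where D: "\<And>k :: int ^ 'n. k \<noteq> 0 \<Longrightarrow> resonant_set m \<alpha> \<gamma> \<tau> M k \<subseteq> D k"
      "\<And>k. k \<noteq> 0 \<Longrightarrow> D k \<in> lmeasurable"
      "\<And>k. k \<noteq> 0 \<Longrightarrow>
        measure lebesgue (D k) \<le> c * (\<gamma> powr (1 / 2) * jap (real_vec k) powr - (real CARD('n) + 1)) * \<mu>"
      by metis
    have finite_bound: "measure lebesgue (\<Union>k\<in>F. D k) \<le> c * S * \<gamma> powr (1 / 2) * \<mu>"
      if F: "F \<subseteq> - {0}" "finite F" for F
    proof -
      have "D k \<in> sets lebesgue" if "k \<in> F" for k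
        using F(1) that by (intro fmeasurableD D(2)) auto
      then have "measure lebesgue (\<Union>k\<in>F. D k) \<le> (\<Sum>k\<in>F. measure lebesgue (D k))"
        using F(2) by (intro measure_UNION_le)
      also have "\<dots> \<le> (\<Sum>k\<in>F. c * (\<gamma> powr (1 / 2) * jap (real_vec k) powr - (real CARD('n) + 1)) * \<mu>)"
        using F(1) by (intro sum_mono D(3)) auto
      also have "\<dots> = c * \<gamma> powr (1 / 2) * \<mu> * (\<Sum>k\<in>F. jap (real_vec k) powr - (real CARD('n) + 1))"
        by (simp add: sum_distrib_left mult_ac)
      also have "\<dots> \<le> c * \<gamma> powr (1 / 2) * \<mu> * S"
        using c \<mu> S(2)[OF F(2)] by (intro mult_left_mono) auto
      finally show ?thesis
        by (simp add: mult_ac)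
    qed
    have D_sub: "A \<subseteq> (\<Union>k\<in>- {0}. D k)"
      using A D(1) by fastforce
    have "(\<Union>k\<in>- {0}. D k) \<in> lmeasurable"
      by (rule fmeasurable_UN_bound[OF countableI_type D(2) finite_bound]) auto
    then have "measure lebesgue A \<le> measure lebesgue (\<Union>k\<in>- {0}. D k)"
      using D_sub by (intro measure_le_of_subset)
    also have "\<dots> \<le> c * S * \<gamma> powr (1 / 2) * \<mu>"
      by (rule measure_UN_bound[OF countableI_type D(2) finite_bound]) auto
    finally show "rel_measure M A \<le> c * S * \<gamma> powr (1 / 2)"
      using \<mu> by (simp add: rel_measure_def field_simps flip: \<mu>_def)
  qed
qed

theorem theorem4p1:
  fixes m \<gamma>0 \<tau>0 \<alpha> \<tau> :: real
  assumes "m \<ge> 0"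
    and "0 < \<gamma>0" and "\<gamma>0 < 1"
    and "\<tau>0 > real CARD('n::finite) - 1"
    and "0 \<le> \<alpha>" and "\<alpha> \<le> 1"
    and "\<tau> \<ge> 2 * real CARD('n) + 3"
  shows "\<exists>C>0. \<forall>M \<gamma> :: real.
    M > 1 \<longrightarrow> M \<ge> M_threshold m \<alpha> \<longrightarrow>
    0 < \<gamma> \<longrightarrow> \<gamma> \<le> min (\<gamma>0 powr (3 / 2)) (1 / 8) \<longrightarrow>
      rel_measure M (Omega0 \<gamma>0 \<tau>0 M - U_set m \<gamma>0 \<tau>0 \<alpha> \<gamma> \<tau> M :: (real ^ 'n) set)
        \<le> C * \<gamma> powr (1 / 3)"
proof -
  obtain C where C: "0 < C"
    "\<And>A M \<gamma>. \<lbrakk>1 < M; 0 < \<gamma>; \<gamma> \<le> 1 / 8; A \<subseteq> (\<Union>k\<in>- {0 :: int ^ 'n}. resonant_set m \<alpha> \<gamma> \<tau> M k)\<rbrakk>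
      \<Longrightarrow> rel_measure M A \<le> C * \<gamma> powr (1 / 2)"
    using measure_UN_resonant_set_le[OF assms(1,5,6,7)] by metis
  \<comment> \<open>Up to \<open>b\<close> the vector \<open>k = 0\<close> is harmless; beyond it \<open>\<gamma> powr (1 / 3)\<close> is bounded below.\<close>
  define b where "b = 1 / (2 * (1 + m))"
  have b: "0 < b"
    using assms(1) by (simp add: b_def)
  define C' where "C' = max C (1 / b powr (1 / 3))"
  show ?thesis
  proof (intro exI[of _ C'] conjI allI impI)
    show "0 < C'"
      using C by (simp add: C'_def)
    fix M \<gamma> :: real
    assume M: "1 < M" and \<gamma>: "0 < \<gamma>" "\<gamma> \<le> min (\<gamma>0 powr (3 / 2)) (1 / 8)"
    let ?A = "Omega0 \<gamma>0 \<tau>0 M - U_set m \<gamma>0 \<tau>0 \<alpha> \<gamma> \<tau> M :: (real ^ 'n) set"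
    show "rel_measure M ?A \<le> C' * \<gamma> powr (1 / 3)"
    proof (cases "\<gamma> \<le> b")
      case True
      then have "rel_measure M ?A \<le> C * \<gamma> powr (1 / 2)"
        using assms M \<gamma> by (intro C(2) Omega0_diff_U_set_subset) (auto simp: b_def)
      also have "\<dots> \<le> C' * \<gamma> powr (1 / 3)"
        using C(1) \<gamma> by (intro mult_mono powr_mono') (auto simp: C'_def)
      finally show ?thesis .
    next
      case False
      have "measure lebesgue ?A \<le> measure lebesgue (annulus M :: (real ^ 'n) set)"
        using M by (intro measure_le_of_subset annulus_lmeasurable) (auto simp: Omega0_def)
      then have "rel_measure M ?A \<le> 1"
        using measure_annulus_pos[of M, where ?'n = 'n] M by (simp add: rel_measure_def)
      also have "1 = 1 / b powr (1 / 3) * b powr (1 / 3)"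
        using b by simp
      also have "\<dots> \<le> C' * \<gamma> powr (1 / 3)"
        using b False C(1) by (intro mult_mono powr_mono2) (auto simp: C'_def)
      finally show ?thesis .
    qed
  qed
qed

end
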